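(* Let $n,m$ be positive integers with $m\le n$, let $A\in\mathbb{R}^{n\times n}$ and $B\in\mathbb{R}^{n\times m}$ with $(A,B)$ stabilizable, and let $f:\mathbb{R}^n\times\mathbb{R}^m\to\mathbb{R}$ be a differentiable convex function. Assume that for each $d\in\mathbb{R}^n$ the optimization problem $$\text{minimize}_{\bar x\in\mathbb{R}^n,\ \bar u\in\mathbb{R}^m}\ f(\bar x,\bar u)\quad\text{subject to}\quad A\bar x+B\bar u+d=0$$ has an optimizer. Let $Q\in\mathbb{R}^{(n+m)\times m}$ be a matrix whose columns form a basis of $\operatorname{null}\begin{bmatrix}A&B\end{bmatrix}$, let $K_P,K_I\in\mathbb{R}^{m\times m}$ with $K_I$ invertible, and suppose the closed-loop system described in the context is well-posed. Then for every $d\in\mathbb{R}^n$, the set $\mathcal{E}$ of equilibrium state-input pairs of the closed-loop system and the set $\chi$ of optimizers of the problem of minimizing $f(\bar x,\bar u)$ over $(\bar x,\bar u)\in\mathbb{R}^n\times\mathbb{R}^m$ subject to $A\bar x+B\bar u+d=0$ (both for this $d$, and both defined in the context) satisfy $\mathcal{E}=\chi$.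
   Context: The pair $(A,B)$ is stabilizable if $\operatorname{rank}\begin{bmatrix}A-\lambda I_n&B\end{bmatrix}=n$ for every complex number $\lambda$ with nonnegative real part. In particular $\operatorname{rank}\begin{bmatrix}A&B\end{bmatrix}=n$, so $\dim\operatorname{null}\begin{bmatrix}A&B\end{bmatrix}=m$. The closed-loop system (plant with state $x\in\mathbb{R}^n$, input $u\in\mathbb{R}^m$ and constant disturbance $d\in\mathbb{R}^n$, in feedback with a proportional-integral controller with state $\eta\in\mathbb{R}^m$) is $$\dot x=Ax+Bu+d,\qquad e=-Q^{\sf T}\nabla f(x,u),\qquad \dot\eta=e,\qquad u=K_I\eta+K_Pe.$$ It is well-posed if, for any $(x,\eta)$, the equations $e=-Q^{\sf T}\nabla f(x,u)$ and $u=K_I\eta+K_Pe$ can be solved for a unique value of $u$. For a constant disturbance $d$, the equilibrium points $(\bar x,\bar\eta)\in\mathbb{R}^n\times\mathbb{R}^m$ of the closed-loop system are the solutions of $$0=A\bar x+B\bar u+d,\qquad 0=Q^{\sf T}\nabla f(\bar x,\bar u),\qquad \bar u=K_I\bar\eta. \qquad ( * )$$ The set of equilibrium state-input pairs is $$\mathcal{E}:=\{(\bar x,\bar u)\in\mathbb{R}^n\times\mathbb{R}^m \mid (\bar x,\bar\eta)=(\bar x,K_I^{-1}\bar u)\text{ solves }( * )\},$$ and the set of optimizers is $$\chi:=\{(x^\star,u^\star)\in\mathbb{R}^n\times\mathbb{R}^m \mid (x^\star,u^\star)\text{ minimizes } f(\bar x,\bar u)\text{ subject to }A\bar x+B\bar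 u+d=0\}.$$ *)

theory Defs
  imports "HOL-Analysis.Analysis"
begin

(* The index type 'n + 'm plays the role of {1..n+m}: Inl indexes the first n entries
   and Inr the last m entries of a block vector or block row. *)

definition hcat :: "'a ^ 'n ^ 'k \<Rightarrow> 'a ^ 'm ^ 'k \<Rightarrow> 'a ^ ('n + 'm) ^ 'k" where
  "hcat M N = (\<chi> i j. case j of Inl p \<Rightarrow> M $ i $ p | Inr q \<Rightarrow> N $ i $ q)"

definition stack :: "('a ^ 'n) \<times> ('a ^ 'm) \<Rightarrow> 'a ^ ('n + 'm)" where
  "stack z = (\<chi> j. case j of Inl p \<Rightarrow> fst z $ p | Inr q \<Rightarrow> snd z $ q)"

definition complexify :: "real ^ 'n ^ 'm \<Rightarrow> complex ^ 'n ^ 'm" where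
  "complexify M = (\<chi> i j. complex_of_real (M $ i $ j))"

definition null_space :: "real ^ 'n ^ 'm \<Rightarrow> (real ^ 'n) set" where
  "null_space M = {v. M *v v = 0}"

(* The columns are taken as an indexed family, so repeated columns are excluded. *)
definition columns_form_basis :: "real ^ 'k ^ 'l \<Rightarrow> (real ^ 'l) set \<Rightarrow> bool" where
  "columns_form_basis Q V \<longleftrightarrow>
     inj (\<lambda>j. column j Q) \<and> independent (columns Q) \<and> span (columns Q) = V"

(* mat l is the matrix l times the identity. *)
definition stabilizable :: "real ^ 'n ^ 'n \<Rightarrow> real ^ 'm ^ 'n \<Rightarrow> bool" where
  "stabilizable A B \<longleftrightarrow>
     (\<forall>l::complex. 0 \<le> Re l \<longrightarrow> rank (hcat (complexify A - mat l) (complexify B)) = CARD('n))"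

(* Meaningful only where f is differentiable; see GDERIV_grad. *)
definition grad :: "('a::euclidean_space \<Rightarrow> real) \<Rightarrow> 'a \<Rightarrow> 'a" where
  "grad f z = (THE g. GDERIV f z :> g)"

definition well_posed ::
  "((real ^ 'n) \<times> (real ^ 'm) \<Rightarrow> real) \<Rightarrow> real ^ 'm ^ ('n + 'm) \<Rightarrow>
   real ^ 'm ^ 'm \<Rightarrow> real ^ 'm ^ 'm \<Rightarrow> bool" where
  "well_posed f Q K\<^sub>P K\<^sub>I \<longleftrightarrow>
     (\<forall>x \<eta>. \<exists>!u. \<exists>e. e = - (transpose Q *v stack (grad f (x, u))) \<and>
                     u = K\<^sub>I *v \<eta> + K\<^sub>P *v e)"

definition equilibrium_point ::
  "real ^ 'n ^ 'n \<Rightarrow> real ^ 'm ^ 'n \<Rightarrow> ((real ^ 'n) \<times> (real ^ 'm) \<Rightarrow> real) \<Rightarrow>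
   real ^ 'm ^ ('n + 'm) \<Rightarrow> real ^ 'm ^ 'm \<Rightarrow> real ^ 'n \<Rightarrow> (real ^ 'n) \<times> (real ^ 'm) \<Rightarrow> bool" where
  "equilibrium_point A B f Q K\<^sub>I d = (\<lambda>(x, \<eta>).
     \<exists>u. 0 = A *v x + B *v u + d \<and>
         0 = transpose Q *v stack (grad f (x, u)) \<and>
         u = K\<^sub>I *v \<eta>)"

definition equilibrium_pairs ::
  "real ^ 'n ^ 'n \<Rightarrow> real ^ 'm ^ 'n \<Rightarrow> ((real ^ 'n) \<times> (real ^ 'm) \<Rightarrow> real) \<Rightarrow>
   real ^ 'm ^ ('n + 'm) \<Rightarrow> real ^ 'm ^ 'm \<Rightarrow> real ^ 'n \<Rightarrow> ((real ^ 'n) \<times> (real ^ 'm)) set" where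
  "equilibrium_pairs A B f Q K\<^sub>I d =
     {(x, u). equilibrium_point A B f Q K\<^sub>I d (x, matrix_inv K\<^sub>I *v u)}"

definition optimizers ::
  "real ^ 'n ^ 'n \<Rightarrow> real ^ 'm ^ 'n \<Rightarrow> ((real ^ 'n) \<times> (real ^ 'm) \<Rightarrow> real) \<Rightarrow>
   real ^ 'n \<Rightarrow> ((real ^ 'n) \<times> (real ^ 'm)) set" where
  "optimizers A B f d =
     {z. is_arg_min f (\<lambda>(x, u). A *v x + B *v u + d = 0) z}"

lemma hcat_mult_stack: "hcat M N *v stack (x, u) = M *v x + N *v u"
  for M :: "real ^ 'n ^ 'k" and N :: "real ^ 'm ^ 'k"
proof -
  have split: "sum g UNIV = (\<Sum>p\<in>UNIV. g (Inl p)) + (\<Sum>q\<in>UNIV. g (Inr q))"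
    for g :: "'n + 'm \<Rightarrow> real"
    using sum.Plus [of "UNIV :: 'n set" "UNIV :: 'm set" g] by (simp add: comp_def)
  show ?thesis
    by (simp add: vec_eq_iff hcat_def stack_def matrix_vector_mult_def split)
qed

lemma GDERIV_grad:
  fixes f :: "'a::euclidean_space \<Rightarrow> real"
  assumes "f differentiable (at z)"
  shows "GDERIV f z :> grad f z"
proof -
  obtain F where F: "(f has_derivative F) (at z)"
    using assms by (auto simp: differentiable_def)
  then have lin: "linear F"
    by (rule has_derivative_linear)
  have "F = (\<lambda>h. h \<bullet> adjoint F 1)"
    using adjoint_works [OF lin, of _ 1] by (simp add: fun_eq_iff)
  then have g: "GDERIV f z :> adjoint F 1"
    using F by (simp add: gderiv_def)
  have "g' = adjoint F 1" if "GDERIV f z :> g'" for g'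
  proof -
    have "(\<lambda>h. h \<bullet> g') = (\<lambda>h. h \<bullet> adjoint F 1)"
      using that g unfolding gderiv_def by (rule has_derivative_unique)
    then have "\<forall>h. h \<bullet> g' = h \<bullet> adjoint F 1"
      by (rule fun_cong [THEN allI])
    then show ?thesis
      by (simp only: vector_eq_ldot)
  qed
  with g show ?thesis
    unfolding grad_def by (rule theI)
qed

end

(* On the affine feasible set a differentiable convex function is minimal exactly where its
   gradient is orthogonal to the direction space, which is the null space of [A B]. As the columns
   of Q span that space, this orthogonality is Q^T grad f = 0. *)
theory Submission
  imports Defs
begin

lemma sum_UNIV_Plus:
  fixes g :: "'n::finite + 'm::finite \<Rightarrow> 'a::comm_monoid_add"
  shows "sum g UNIV = (\<Sum>p\<in>UNIV. g (Inl p)) + (\<Sum>q\<in>UNIV. g (Inr q))"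
  using sum.Plus [of "UNIV :: 'n set" "UNIV :: 'm set" g] by (simp add: comp_def)

text \<open>\<open>grad f\<close> lives in the product space, while \<open>Q\<close> acts on block
  vectors. Since \<open>stack\<close> preserves inner products, orthogonality can be moved between
  the two.\<close>

lemma inner_stack: "stack z \<bullet> stack w = z \<bullet> w"
  for z w :: "(real ^ 'n) \<times> (real ^ 'm)"
  by (simp add: inner_vec_def inner_prod_def sum_UNIV_Plus stack_def)

lemma surj_stack: "surj (stack :: ('a ^ 'n) \<times> ('a ^ 'm) \<Rightarrow> 'a ^ ('n::finite + 'm::finite))"
proof (rule surjI)
  show "stack (\<chi> p. v $ Inl p, \<chi> q. v $ Inr q) = v" for v :: "'a ^ ('n + 'm)"
    by (simp add: stack_def vec_eq_iff split: sum.split)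
qed

text \<open>The entries of \<open>transpose Q *v g\<close> are the inner products of the columns
  with \<open>g\<close>, and orthogonality to \<open>g\<close> survives linear combinations.\<close>

lemma transpose_mult_eq_0_iff:
  fixes Q :: "real ^ 'k ^ 'l"
  shows "transpose Q *v g = 0 \<longleftrightarrow> (\<forall>v\<in>span (columns Q). v \<bullet> g = 0)"
proof -
  have "transpose Q *v g = 0 \<longleftrightarrow> (\<forall>v\<in>columns Q. v \<bullet> g = 0)"
    by (auto simp: vec_eq_iff [of _ 0] matrix_mult_dot columns_def column_def
        transpose_def)
  also have "\<dots> \<longleftrightarrow> (\<forall>v\<in>span (columns Q). v \<bullet> g = 0)"
    using orthogonal_to_span [of _ "columns Q" g]
    by (auto simp: orthogonal_def inner_commute intro: span_base)
  finally show ?thesis .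
qed

text \<open>Restricting \<open>f\<close> to the line through \<open>z\<close> in direction
  \<open>v\<close> gives a convex function of one real variable whose derivative at 0 is
  \<open>v \<bullet> g\<close>, so both directions reduce to calculus on the real line.\<close>

lemma convex_minimal_on_affine_iff_orthogonal_gradient:
  fixes f :: "'a::real_inner \<Rightarrow> real"
  assumes convex: "convex_on UNIV f" and grad: "GDERIV f z :> g" and S: "subspace S"
  shows "(\<forall>v\<in>S. f z \<le> f (z + v)) \<longleftrightarrow> (\<forall>v\<in>S. v \<bullet> g = 0)"
proof -
  have deriv: "((\<lambda>t. f (z + t *\<^sub>R v)) has_real_derivative v \<bullet> g) (at 0)" for v
  proof -
    have "((\<lambda>t. z + t *\<^sub>R v) has_derivative (\<lambda>t. t *\<^sub>R v)) (at (0::real))"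
      by (auto intro!: derivative_eq_intros)
    \<comment> \<open>The base point is written as the value of the line at 0, the form that the
      chain rule needs.\<close>
    moreover have "(f has_derivative (\<lambda>h. h \<bullet> g)) (at (z + 0 *\<^sub>R v))"
      using grad by (simp add: gderiv_def)
    ultimately have "((\<lambda>t. f (z + t *\<^sub>R v)) has_derivative (\<lambda>t. (t *\<^sub>R v) \<bullet> g)) (at 0)"
      by (rule has_derivative_compose)
    then show ?thesis
      by (simp add: has_field_derivative_def mult.commute [of _ "v \<bullet> g"])
  qed
  show ?thesis
  proof (intro iffI ballI)
    fix v assume min: "\<forall>v\<in>S. f z \<le> f (z + v)" and "v \<in> S"
    then have "f (z + 0 *\<^sub>R v) \<le> f (z + t *\<^sub>R v)" for t
      using subspace_scale [OF S] by simp
    \<comment> \<open>As \<open>S\<close> contains all multiples of \<open>v\<close>, negative ones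
      included, 0 is a two-sided minimum along the line. The minimum is global there, so the radius
      1 is arbitrary.\<close>
    then show "v \<bullet> g = 0"
      by (intro DERIV_local_min [OF deriv, of 1]) simp_all
  next
    fix v assume "\<forall>v\<in>S. v \<bullet> g = 0" and "v \<in> S"
    moreover have "convex_on UNIV (\<lambda>t. f (z + t *\<^sub>R v))"
    proof (rule convex_onI)
      fix t x y :: real assume t: "0 < t" "t < 1"
      have "z + ((1 - t) *\<^sub>R x + t *\<^sub>R y) *\<^sub>R v
          = (1 - t) *\<^sub>R (z + x *\<^sub>R v) + t *\<^sub>R (z + y *\<^sub>R v)"
        by (simp add: algebra_simps)
      then show "f (z + ((1 - t) *\<^sub>R x + t *\<^sub>R y) *\<^sub>R v)
          \<le> (1 - t) * f (z + x *\<^sub>R v) + t * f (z + y *\<^sub>R v)"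
        using convex_onD [OF convex, of t "z + x *\<^sub>R v" "z + y *\<^sub>R v"] t by simp
    qed simp
    \<comment> \<open>The tangent at 0 is horizontal and lies below the convex function; comparing
      the two at 1 gives the claim.\<close>
    ultimately show "f z \<le> f (z + v)"
      using convex_on_imp_above_tangent [of UNIV "\<lambda>t. f (z + t *\<^sub>R v)" 0 1 "v \<bullet> g"]
        deriv [of v] by simp
  qed
qed

lemma feasible_add_iff:
  fixes A :: "real ^ 'n ^ 'k" and B :: "real ^ 'm ^ 'k"
  assumes "A *v x + B *v u + d = 0"
  shows "A *v (x + x') + B *v (u + u') + d = 0 \<longleftrightarrow> stack (x', u') \<in> null_space (hcat A B)"
proof -
  have "A *v (x + x') + B *v (u + u') + d = (A *v x + B *v u + d) + (A *v x' + B *v u')"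
    by (simp add: matrix_vector_right_distrib algebra_simps)
  then show ?thesis
    by (simp add: assms null_space_def hcat_mult_stack)
qed

lemma optimizer_iff_gradient_orthogonal_null_space:
  fixes A :: "real ^ 'n ^ 'n" and B :: "real ^ 'm ^ 'n"
  assumes diff: "f differentiable (at (x, u))" and convex: "convex_on UNIV f"
  shows "(x, u) \<in> optimizers A B f d \<longleftrightarrow>
    A *v x + B *v u + d = 0 \<and> (\<forall>v\<in>null_space (hcat A B). v \<bullet> stack (grad f (x, u)) = 0)"
proof (cases "A *v x + B *v u + d = 0")
  case feasible: True
  \<comment> \<open>The null space is pulled back along \<open>stack\<close> to the space of pairs,
    where \<open>f\<close> is defined.\<close>
  define S where "S = {z. A *v fst z + B *v snd z = 0}"
  have S_iff: "z \<in> S \<longleftrightarrow> stack z \<in> null_space (hcat A B)" for z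
    by (cases z) (simp add: S_def null_space_def hcat_mult_stack)
  have "linear (\<lambda>z. A *v fst z + B *v snd z)"
    by (rule linearI) (simp_all add: matrix_vector_mult_scaleR algebra_simps)
  then have "subspace S"
    unfolding S_def by (rule linear_subspace_kernel)
  have "(x, u) \<in> optimizers A B f d \<longleftrightarrow>
      (\<forall>y w. A *v y + B *v w + d = 0 \<longrightarrow> f (x, u) \<le> f (y, w))"
    using feasible by (auto simp: optimizers_def is_arg_min_def not_less)
  \<comment> \<open>Substitute \<open>x' = y - x\<close> and \<open>u' = w - u\<close>, so that
    competitors become displacements from \<open>(x, u)\<close>.\<close>
  also have "\<dots> \<longleftrightarrow> (\<forall>x' u'. A *v (x + x') + B *v (u + u') + d = 0
      \<longrightarrow> f (x, u) \<le> f (x + x', u + u'))"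
    by (metis add_diff_cancel_left' diff_add_cancel)
  also have "\<dots> \<longleftrightarrow> (\<forall>v\<in>S. f (x, u) \<le> f ((x, u) + v))"
    by (simp add: Ball_def split_paired_All S_iff feasible_add_iff [OF feasible])
  also have "\<dots> \<longleftrightarrow> (\<forall>v\<in>S. v \<bullet> grad f (x, u) = 0)"
    using convex GDERIV_grad [OF diff] \<open>subspace S\<close>
    by (rule convex_minimal_on_affine_iff_orthogonal_gradient)
  also have "\<dots> \<longleftrightarrow> (\<forall>v\<in>null_space (hcat A B). v \<bullet> stack (grad f (x, u)) = 0)"
  proof -
    have "S = stack -` null_space (hcat A B)"
      by (auto simp: S_iff)
    \<comment> \<open>The image of a preimage under the surjection \<open>stack\<close> is the whole
      set.\<close>
    then have "null_space (hcat A B) = stack ` S"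
      by (simp add: surj_stack)
    then show ?thesis
      by (simp add: inner_stack)
  qed
  finally show ?thesis
    using feasible by simp
qed (simp add: optimizers_def is_arg_min_def)

theorem mainTheorem1:
  fixes A :: "real ^ 'n ^ 'n" and B :: "real ^ 'm ^ 'n"
    and f :: "(real ^ 'n) \<times> (real ^ 'm) \<Rightarrow> real"
    and Q :: "real ^ 'm ^ ('n + 'm)"
    and K\<^sub>P K\<^sub>I :: "real ^ 'm ^ 'm"
  assumes "CARD('m) \<le> CARD('n)"
    and "stabilizable A B"
    and "\<forall>z. f differentiable (at z)"
    and "convex_on UNIV f"
    and "\<forall>d. \<exists>z. z \<in> optimizers A B f d"
    and "columns_form_basis Q (null_space (hcat A B))"
    and "invertible K\<^sub>I"
    and "well_posed f Q K\<^sub>P K\<^sub>I"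
  shows "\<forall>d. equilibrium_pairs A B f Q K\<^sub>I d = optimizers A B f d"
proof (intro allI set_eqI)
  fix d and z :: "(real ^ 'n) \<times> (real ^ 'm)"
  obtain x u where z: "z = (x, u)"
    by (cases z)
  \<comment> \<open>This right inverse makes every \<open>u\<close> reachable as an equilibrium
    input, with integrator state \<open>matrix_inv K\<^sub>I *v u\<close>; the input quantified in
    \<open>equilibrium_point\<close> is then \<open>u\<close> itself.\<close>
  have "K\<^sub>I ** matrix_inv K\<^sub>I = mat 1"
    using assms(7) unfolding invertible_def matrix_inv_def by (metis (mono_tags, lifting) someI_ex)
  then have inv: "K\<^sub>I *v (matrix_inv K\<^sub>I *v u) = u"
    by (simp add: matrix_vector_mul_assoc)
  have span: "span (columns Q) = null_space (hcat A B)"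
    using assms(6) by (simp add: columns_form_basis_def)
  have "z \<in> equilibrium_pairs A B f Q K\<^sub>I d \<longleftrightarrow>
      A *v x + B *v u + d = 0 \<and> transpose Q *v stack (grad f (x, u)) = 0"
    by (auto simp: z equilibrium_pairs_def equilibrium_point_def inv)
  also have "\<dots> \<longleftrightarrow> z \<in> optimizers A B f d"
    unfolding z transpose_mult_eq_0_iff span
    using assms(3,4) by (simp add: optimizer_iff_gradient_orthogonal_null_space)
  finally show "z \<in> equilibrium_pairs A B f Q K\<^sub>I d \<longleftrightarrow> z \<in> optimizers A B f d" .
qed

end
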